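(* The structure $\mathcal{N}$ (the Fra\"{i}ss\'{e} limit $\mathcal{M}$ of the class $K$, expanded by a linear order of type $\omega_1^{CK}(1+\eta)$ on its $E$-equivalence classes) has an indiscernible sequence of imaginaries.
   Context: $\omega_1^{CK}$ is the least non-computable ordinal, $\eta$ is the order type of the rationals, and the Harrison ordering is a computable linear order of type $\omega_1^{CK}(1+\eta)$. The class $K$. The signature consists of binary relations $E$ and $(C_i)_{i\in\omega}$. A finite structure is in $K$ if $E$ is an equivalence relation; the $C_i$ color the unordered pairs of distinct elements ($xC_iy$ iff $yC_ix$, the $C_i$ hold only between distinct elements) with exactly one color $i$ per pair; and there are no monochromatic triangles, i.e., there are no $i\in\omega$ and $x,y,z$ with $xC_iy$, $yC_iz$ and $zC_ix$. The class $K$ has the hereditary, amalgamation and joint embedding properties; let $\mathcal{M}$ be its (computable) Fra\"{i}ss\'{e} limit. In $\mathcal{M}$ there are infinitely many $E$-classes, all infinite. Let $R$ be an (effective) map from $\mathcal{M}$ onto the Harrison ordering $\omega_1^{CK}(1+\eta)$ such that $R(x)=R(y)$ iff $xEy$. The structure $\mathcal{N}$ is the expansion of $\mathcal{M}$ by the relation $\leq$, where $x\leq y$ iff $R(x)\leq R(y)$. An indiscernible sequence of imaginaries of a structure $\mathcal{A}$ is a sequence $(E_i)_{i\in\omega}$ of pairwise distinct equivalence classes of elements of $\mathcal{A}$, modulo some equivalence relation definable in $\mathcal{A}$ by an $L_{\omega_1\omega}$ formula without parameters, such that for any $n$ and any $i_1<\dots<i_n$ and $j_1<\dots<j_n$ there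 is an automorphism of $\mathcal{A}$ mapping $E_{i_k}$ to $E_{j_k}$ for each $k=1,\dots,n$. *)

theory Defs
  imports "HOL-Library.Option_ord" "HOL-Library.Countable_Set"
begin

section \<open>Structures with binary relation symbols\<close>

text \<open>Every signature needed here is purely relational with binary symbols, so a structure
  is a domain together with a binary relation for each symbol \<open>'r\<close>. Only the restriction of
  the relations to the domain is meaningful.\<close>

record ('a, 'r) bstruct =
  dom_of :: "'a set"
  rel_of :: "'r \<Rightarrow> 'a \<Rightarrow> 'a \<Rightarrow> bool"

definition embedding :: "('a, 'r) bstruct \<Rightarrow> ('b, 'r) bstruct \<Rightarrow> ('a \<Rightarrow> 'b) \<Rightarrow> bool" where
  "embedding A B f \<longleftrightarrow> inj_on f (dom_of A) \<and> f ` dom_of A \<subseteq> dom_of B \<and>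
     (\<forall>r. \<forall>x\<in>dom_of A. \<forall>y\<in>dom_of A. rel_of A r x y \<longleftrightarrow> rel_of B r (f x) (f y))"

definition isomorphism :: "('a, 'r) bstruct \<Rightarrow> ('b, 'r) bstruct \<Rightarrow> ('a \<Rightarrow> 'b) \<Rightarrow> bool" where
  "isomorphism A B f \<longleftrightarrow> embedding A B f \<and> f ` dom_of A = dom_of B"

definition automorphism :: "('a, 'r) bstruct \<Rightarrow> ('a \<Rightarrow> 'a) \<Rightarrow> bool" where
  "automorphism A f \<longleftrightarrow> isomorphism A A f"

definition substructure_on :: "('a, 'r) bstruct \<Rightarrow> 'a set \<Rightarrow> ('a, 'r) bstruct" where
  "substructure_on A S = A\<lparr>dom_of := S\<rparr>"

definition ultrahomogeneous :: "('a, 'r) bstruct \<Rightarrow> bool" where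
  "ultrahomogeneous M \<longleftrightarrow>
     (\<forall>S T f. finite S \<and> S \<subseteq> dom_of M \<and> T \<subseteq> dom_of M \<and>
        isomorphism (substructure_on M S) (substructure_on M T) f \<longrightarrow>
        (\<exists>g. automorphism M g \<and> (\<forall>x\<in>S. g x = f x)))"

text \<open>A class of finite structures, closed under isomorphism, is given by its members with
  domain a finite set of natural numbers. As signatures are relational, finitely generated
  means finite, and the second conjunct says that the age of \<open>M\<close> is \<open>\<K>\<close>.\<close>

definition fraisse_limit :: "((nat, 'r) bstruct \<Rightarrow> bool) \<Rightarrow> ('a, 'r) bstruct \<Rightarrow> bool" where
  "fraisse_limit \<K> M \<longleftrightarrow>
     countable (dom_of M) \<and>
     (\<forall>A. finite (dom_of A) \<longrightarrow> (\<K> A \<longleftrightarrow> (\<exists>f. embedding A M f))) \<and>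
     ultrahomogeneous M"

section \<open>Infinitary formulas and indiscernible sequences of imaginaries\<close>

text \<open>\<open>L\<^bsub>\<omega>\<^sub>1\<omega>\<^esub>\<close>-formulas with variables indexed by the natural numbers; the remaining
  connectives and quantifiers are definable. A formula with finitely many free variables has
  only subformulas with finitely many free variables, since each subformula lies in the scope
  of finitely many quantifiers.\<close>

datatype 'r form =
    FRel 'r nat nat
  | FEq nat nat
  | FNot "'r form"
  | FConj "nat \<Rightarrow> 'r form"
  | FEx nat "'r form"

primrec free_vars :: "'r form \<Rightarrow> nat set" where
  "free_vars (FRel r i j) = {i, j}"
| "free_vars (FEq i j) = {i, j}"
| "free_vars (FNot p) = free_vars p"
| "free_vars (FConj ps) = (\<Union>n. free_vars (ps n))"
| "free_vars (FEx i p) = free_vars p - {i}"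

primrec satisfies :: "('a, 'r) bstruct \<Rightarrow> 'r form \<Rightarrow> (nat \<Rightarrow> 'a) \<Rightarrow> bool" where
  "satisfies A (FRel r i j) s \<longleftrightarrow> rel_of A r (s i) (s j)"
| "satisfies A (FEq i j) s \<longleftrightarrow> s i = s j"
| "satisfies A (FNot p) s \<longleftrightarrow> \<not> satisfies A p s"
| "satisfies A (FConj ps) s \<longleftrightarrow> (\<forall>n. satisfies A (ps n) s)"
| "satisfies A (FEx i p) s \<longleftrightarrow> (\<exists>a\<in>dom_of A. satisfies A p (s(i := a)))"

text \<open>The variables 0 and 1 stand for the two arguments; the values given to the other
  variables do not matter for formulas with free variables among 0 and 1.\<close>

definition defined_relation :: "('a, 'r) bstruct \<Rightarrow> 'r form \<Rightarrow> ('a \<times> 'a) set" where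
  "defined_relation A p =
     {(x, y) \<in> dom_of A \<times> dom_of A. satisfies A p (\<lambda>n. if n = 0 then x else y)}"

definition definable_equivalence :: "('a, 'r) bstruct \<Rightarrow> ('a \<times> 'a) set \<Rightarrow> bool" where
  "definable_equivalence A Q \<longleftrightarrow> equiv (dom_of A) Q \<and>
     (\<exists>p. free_vars p \<subseteq> {0, 1} \<and> Q = defined_relation A p)"

definition indiscernible_imaginaries :: "('a, 'r) bstruct \<Rightarrow> (nat \<Rightarrow> 'a set) \<Rightarrow> bool" where
  "indiscernible_imaginaries A X \<longleftrightarrow>
     (\<exists>Q. definable_equivalence A Q \<and> (\<forall>n. X n \<in> dom_of A // Q)) \<and>
     inj X \<and>
     (\<forall>(n::nat) (i::nat \<Rightarrow> nat) (j::nat \<Rightarrow> nat).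
        strict_mono_on {1..n} i \<and> strict_mono_on {1..n} j \<longrightarrow>
        (\<exists>g. automorphism A g \<and> (\<forall>k\<in>{1..n}. g ` X (i k) = X (j k))))"

section \<open>Computability\<close>

text \<open>\<open>recursive n f\<close>: the function \<open>f\<close>, restricted to lists of length \<open>n\<close>, is a total
  (general) recursive function of \<open>n\<close> arguments. Minimisation is applied to regular functions
  only, so every function generated is total.\<close>

inductive recursive :: "nat \<Rightarrow> (nat list \<Rightarrow> nat) \<Rightarrow> bool" where
  zero: "recursive n (\<lambda>xs. 0)"
| succ: "recursive 1 (\<lambda>xs. Suc (xs ! 0))"
| proj: "i < n \<Longrightarrow> recursive n (\<lambda>xs. xs ! i)"
| comp: "recursive (length gs) f \<Longrightarrow> (\<forall>g\<in>set gs. recursive n g) \<Longrightarrow>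
    recursive n (\<lambda>xs. f (map (\<lambda>g. g xs) gs))"
| prec: "recursive n f \<Longrightarrow> recursive (Suc (Suc n)) g \<Longrightarrow>
    recursive (Suc n) (\<lambda>xs. rec_nat (f (tl xs)) (\<lambda>k v. g (k # v # tl xs)) (hd xs))"
| mini: "recursive (Suc n) f \<Longrightarrow> (\<forall>xs. length xs = n \<longrightarrow> (\<exists>k. f (k # xs) = 0)) \<Longrightarrow>
    recursive n (\<lambda>xs. LEAST k. f (k # xs) = 0)"

definition computable_predicate :: "nat \<Rightarrow> (nat list \<Rightarrow> bool) \<Rightarrow> bool" where
  "computable_predicate n P \<longleftrightarrow>
     (\<exists>f. recursive n f \<and> (\<forall>xs. length xs = n \<longrightarrow> f xs = (if P xs then 1 else 0)))"

definition computable_rel :: "nat rel \<Rightarrow> bool" where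
  "computable_rel r \<longleftrightarrow> computable_predicate 2 (\<lambda>xs. (xs ! 0, xs ! 1) \<in> r)"

definition computable_map_on :: "nat set \<Rightarrow> (nat \<Rightarrow> nat) \<Rightarrow> bool" where
  "computable_map_on D h \<longleftrightarrow> (\<exists>f. recursive 1 f \<and> (\<forall>x\<in>D. h x = f [x]))"

section \<open>The Harrison ordering\<close>

text \<open>Orders are reflexive relations whose carrier is their field, as in the library theory
  of well-orders; the field of a computable reflexive relation is computable.\<close>

definition computable_ordinal :: "'a rel \<Rightarrow> bool" where
  "computable_ordinal r \<longleftrightarrow>
     (\<exists>s :: nat rel. Well_order s \<and> computable_rel s \<and> (s, r) \<in> ordIso)"

text \<open>\<open>r\<close> has order type \<open>\<omega>\<^sub>1\<^bsup>CK\<^esup>\<close>. Every ordinal below the type of \<open>r\<close> is the type of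
  a well-order on the same HOL type as \<open>r\<close>.\<close>

definition is_omega1_CK :: "'a rel \<Rightarrow> bool" where
  "is_omega1_CK r \<longleftrightarrow> Well_order r \<and> \<not> computable_ordinal r \<and>
     (\<forall>s :: 'a rel. (s, r) \<in> ordLess \<longrightarrow> computable_ordinal s)"

text \<open>The product of the order type of \<open>r\<close> with \<open>1 + \<eta>\<close>: the type \<open>rat option\<close>, ordered
  with \<open>None\<close> as bottom, has order type \<open>1 + \<eta>\<close>, and each of its points is replaced by a
  copy of \<open>r\<close> (so the coordinate in \<open>1 + \<eta>\<close> is the dominant one).\<close>

definition times_one_plus_eta :: "'a rel \<Rightarrow> (rat option \<times> 'a) rel" where
  "times_one_plus_eta r =
     {((p, a), (q, b)). a \<in> Field r \<and> b \<in> Field r \<and> (p < q \<or> p = q \<and> (a, b) \<in> r)}"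

definition order_isomorphic :: "'a rel \<Rightarrow> 'b rel \<Rightarrow> bool" where
  "order_isomorphic r s \<longleftrightarrow> (\<exists>f. bij_betw f (Field r) (Field s) \<and>
     (\<forall>x\<in>Field r. \<forall>y\<in>Field r. (x, y) \<in> r \<longleftrightarrow> (f x, f y) \<in> s))"

definition harrison_ordering :: "nat rel \<Rightarrow> bool" where
  "harrison_ordering L \<longleftrightarrow> Linear_order L \<and> computable_rel L \<and>
     (\<exists>W :: nat rel. is_omega1_CK W \<and> order_isomorphic L (times_one_plus_eta W))"

section \<open>The class \<open>K\<close> and the structure \<open>\<N>\<close>\<close>

datatype ksym = SymE | SymC nat

definition class_K :: "('a, ksym) bstruct \<Rightarrow> bool" where
  "class_K A \<longleftrightarrow>
     (let D = dom_of A; E = rel_of A SymE; C = (\<lambda>i. rel_of A (SymC i)) in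
        finite D \<and>
        equiv D {(x, y) \<in> D \<times> D. E x y} \<and>
        (\<forall>i. \<forall>x\<in>D. \<forall>y\<in>D. C i x y \<longleftrightarrow> C i y x) \<and>
        (\<forall>i. \<forall>x\<in>D. \<not> C i x x) \<and>
        (\<forall>x\<in>D. \<forall>y\<in>D. x \<noteq> y \<longrightarrow> (\<exists>!i. C i x y)) \<and>
        \<not> (\<exists>i. \<exists>x\<in>D. \<exists>y\<in>D. \<exists>z\<in>D. C i x y \<and> C i y z \<and> C i z x))"

text \<open>Computability of a structure in an infinite signature is uniform in the index of the
  relation symbol.\<close>

definition computable_kstructure :: "(nat, ksym) bstruct \<Rightarrow> bool" where
  "computable_kstructure M \<longleftrightarrow>
     computable_predicate 1 (\<lambda>xs. xs ! 0 \<in> dom_of M) \<and>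
     computable_rel {(x, y) \<in> dom_of M \<times> dom_of M. rel_of M SymE x y} \<and>
     computable_predicate 3 (\<lambda>xs. xs ! 1 \<in> dom_of M \<and> xs ! 2 \<in> dom_of M \<and>
       rel_of M (SymC (xs ! 0)) (xs ! 1) (xs ! 2))"

definition ranking :: "(nat, ksym) bstruct \<Rightarrow> nat rel \<Rightarrow> (nat \<Rightarrow> nat) \<Rightarrow> bool" where
  "ranking M L R \<longleftrightarrow> computable_map_on (dom_of M) R \<and>
     R ` dom_of M = Field L \<and>
     (\<forall>x\<in>dom_of M. \<forall>y\<in>dom_of M. R x = R y \<longleftrightarrow> rel_of M SymE x y)"

datatype nsym = SymK ksym | SymLe

definition expansion_N ::
  "(nat, ksym) bstruct \<Rightarrow> nat rel \<Rightarrow> (nat \<Rightarrow> nat) \<Rightarrow> (nat, nsym) bstruct" where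
  "expansion_N M L R =
     \<lparr>dom_of = dom_of M,
      rel_of = (\<lambda>s x y. case s of SymK k \<Rightarrow> rel_of M k x y | SymLe \<Rightarrow> (R x, R y) \<in> L)\<rparr>"

end

theory Submission
  imports Defs
begin

text \<open>
  The imaginaries are \<open>E\<close>-classes, which correspond to the points of the Harrison ordering. Two
  observations make some of them indiscernible.

  First, the Harrison ordering has many automorphisms. In a copy of \<open>W(1 + \<eta>)\<close>, with \<open>W\<close> a
  nonempty well-order, every automorphism of the rationals acts by permuting the copies of \<open>W\<close>
  indexed by \<open>\<eta>\<close>. Fix a point \<open>a\<close> of \<open>W\<close> and consider its occurrences in the copies indexed by
  \<open>0, 1, 2, \<dots>\<close>. As any finite partial order isomorphism of the rationals extends to an
  automorphism (\<open>countable_dense_order_homogeneous\<close>), any increasing tuple of these occurrences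
  can be moved to any other by an automorphism of the ordering
  (\<open>harrison_ordering_indiscernibles\<close>).

  Second, the equivalence relation of \<open>\<M>\<close> is so independent of the colours that every permutation
  of the \<open>E\<close>-classes whatsoever is induced by an automorphism of \<open>\<M>\<close>
  (\<open>lift_class_permutation\<close>). When the permutation comes from an automorphism of the ordering,
  the automorphism of \<open>\<M>\<close> also preserves \<open>\<le>\<close>, so it is an automorphism of \<open>\<N>\<close>.
  The lifting is a back-and-forth construction. Its step requires an element with prescribed
  colours to a finite set, in a prescribed class that need not meet this set
  (\<open>extension_property\<close>). The class is named by one of its elements \<open>w\<close>, and since infinitely
  many colours are available, the new element may be joined to \<open>w\<close> by a colour that creates no
  monochromatic triangle.
\<close>

section \<open>The back-and-forth method\<close>

text \<open>The relation \<open>T\<close> expresses what two pairs of corresponding elements must satisfy in order to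
  belong to the same partial isomorphism; enumerating both sides turns the one-point extensions
  into a total bijection. Since \<open>T\<close> concerns two pairs at a time, the union of the chain of finite
  approximations still satisfies it. In the extension steps \<open>v\<close> ranges over the new
  pair as well, because \<open>T\<close> may restrict a single pair and need not be symmetric.\<close>

lemma back_and_forth:
  fixes A :: "'a set" and B :: "'b set" and T :: "'a \<times> 'b \<Rightarrow> 'a \<times> 'b \<Rightarrow> bool"
  defines "ok p \<equiv> finite p \<and> p \<subseteq> A \<times> B \<and> (\<forall>u\<in>p. \<forall>v\<in>p. T u v)"
  assumes count: "countable A" "countable B"
    and start: "ok p0"
    and inj: "\<And>a b a' b'. T (a, b) (a', b') \<Longrightarrow> a = a' \<longleftrightarrow> b = b'"
    and forward: "\<And>p a. ok p \<Longrightarrow> a \<in> A \<Longrightarrow>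
      \<exists>b\<in>B. \<forall>v\<in>insert (a, b) p. T (a, b) v \<and> T v (a, b)"
    and backward: "\<And>p b. ok p \<Longrightarrow> b \<in> B \<Longrightarrow>
      \<exists>a\<in>A. \<forall>v\<in>insert (a, b) p. T (a, b) v \<and> T v (a, b)"
  obtains f where "bij_betw f A B" and "\<And>a b. (a, b) \<in> p0 \<Longrightarrow> f a = b"
    and "\<And>a a'. a \<in> A \<Longrightarrow> a' \<in> A \<Longrightarrow> T (a, f a) (a', f a')"
proof -
  have ok_insert: "ok (insert (a, b) p)"
    if "ok p" "a \<in> A" "b \<in> B" "\<forall>v\<in>insert (a, b) p. T (a, b) v \<and> T v (a, b)" for p a b
    using that unfolding ok_def by auto
  have ext_dom: "\<exists>b. ok (insert (a, b) p)" if "ok p" "a \<in> A" for p a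
    using forward[OF that] ok_insert that by blast
  have ext_ran: "\<exists>a. ok (insert (a, b) p)" if "ok p" "b \<in> B" for p b
    using backward[OF that] ok_insert that by blast
  define cover where "cover n p \<longleftrightarrow>
      (from_nat_into A n \<in> A \<longrightarrow> from_nat_into A n \<in> Domain p) \<and>
      (from_nat_into B n \<in> B \<longrightarrow> from_nat_into B n \<in> Range p)" for n p
  have step: "\<exists>p'. ok p' \<and> p \<subseteq> p' \<and> cover n p'" if ok_p: "ok p" for p n
  proof -
    obtain p1 where 1: "ok p1" "p \<subseteq> p1" "from_nat_into A n \<in> A \<longrightarrow> from_nat_into A n \<in> Domain p1"
      using ok_p ext_dom[of p "from_nat_into A n"]
      by (metis Domain.DomainI insertI1 order_refl subset_insertI)
    obtain p2 where 2: "ok p2" "p1 \<subseteq> p2" "from_nat_into B n \<in> B \<longrightarrow> from_nat_into B n \<in> Range p2"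
      using 1(1) ext_ran[of p1 "from_nat_into B n"]
      by (metis Range.RangeI insertI1 order_refl subset_insertI)
    show ?thesis
      using 1 2 Domain_mono[OF 2(2)] unfolding cover_def by blast
  qed
  \<comment> \<open>Stage \<open>n + 1\<close> of the chain takes care of the \<open>n\<close>-th element of each side.\<close>
  obtain P where P: "\<And>n. ok (P n) \<and> p0 \<subseteq> P n" "\<And>n. P n \<subseteq> P (Suc n) \<and> cover n (P (Suc n))"
  proof -
    have "\<exists>P. \<forall>n. (ok (P n) \<and> p0 \<subseteq> P n) \<and> P n \<subseteq> P (Suc n) \<and> cover n (P (Suc n))"
    proof (rule dependent_nat_choice)
      show "\<exists>p. ok p \<and> p0 \<subseteq> p" using start by blast
      show "\<exists>p'. (ok p' \<and> p0 \<subseteq> p') \<and> p \<subseteq> p' \<and> cover n p'" if "ok p \<and> p0 \<subseteq> p" for p n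
        using step[of p n] that by blast
    qed
    then show thesis using that by blast
  qed
  have mono: "P m \<subseteq> P n" if "m \<le> n" for m n
    by (rule lift_Suc_mono_le[of P]) (use P(2) that in auto)
  define G where "G = (\<Union>n. P n)"
  have GT: "T u v" if uv: "u \<in> G" "v \<in> G" for u v
  proof -
    obtain m n where "u \<in> P m" "v \<in> P n" using uv unfolding G_def by blast
    then have "u \<in> P (max m n)" "v \<in> P (max m n)"
      using mono[of m "max m n"] mono[of n "max m n"] by auto
    then show ?thesis using P(1) unfolding ok_def by blast
  qed
  have GAB: "G \<subseteq> A \<times> B" using P(1) unfolding G_def ok_def by blast
  have dom: "\<exists>b. (a, b) \<in> G" if a: "a \<in> A" for a
  proof -
    have "from_nat_into A (to_nat_on A a) = a"
      using a count by simp
    then have "a \<in> Domain (P (Suc (to_nat_on A a)))"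
      using P(2)[of "to_nat_on A a"] a unfolding cover_def by simp
    then show ?thesis unfolding G_def by blast
  qed
  have ran: "\<exists>a. (a, b) \<in> G" if b: "b \<in> B" for b
  proof -
    have "from_nat_into B (to_nat_on B b) = b"
      using b count by simp
    then have "b \<in> Range (P (Suc (to_nat_on B b)))"
      using P(2)[of "to_nat_on B b"] b unfolding cover_def by simp
    then show ?thesis unfolding G_def by blast
  qed
  have Ginj: "a = a' \<longleftrightarrow> b = b'" if "(a, b) \<in> G" "(a', b') \<in> G" for a b a' b'
    using inj GT that by blast
  define f where "f a = (SOME b. (a, b) \<in> G)" for a
  have f: "(a, f a) \<in> G" if "a \<in> A" for a
    unfolding f_def using dom[OF that] by (rule someI_ex)
  show thesis
  proof
    show "bij_betw f A B"
      unfolding bij_betw_def inj_on_def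
    proof (intro conjI ballI impI)
      show "a = a'" if "a \<in> A" "a' \<in> A" "f a = f a'" for a a'
        using f Ginj that by metis
      show "f ` A = B"
      proof
        show "f ` A \<subseteq> B" using f GAB by blast
        show "B \<subseteq> f ` A"
        proof
          fix b assume "b \<in> B"
          then obtain a where "(a, b) \<in> G" using ran by blast
          moreover from this have "a \<in> A" using GAB by blast
          ultimately have "b = f a" using f[of a] Ginj[of a b a "f a"] by simp
          with \<open>a \<in> A\<close> show "b \<in> f ` A" by blast
        qed
      qed
    qed
    show "f a = b" if "(a, b) \<in> p0" for a b
    proof -
      have ab: "(a, b) \<in> G" using that P(1)[of 0] unfolding G_def by blast
      then have "a \<in> A" using GAB by blast
      then show ?thesis using Ginj[OF f ab, of a] by simp
    qed
    show "T (a, f a) (a', f a')" if "a \<in> A" "a' \<in> A" for a a'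
      using GT f that by blast
  qed
qed

section \<open>Homogeneity of countable dense linear orders\<close>

lemma between_finite_sets:
  fixes A B :: "'a :: {dense_linorder, no_top, no_bot} set"
  assumes "finite A" "finite B" "\<And>a b. a \<in> A \<Longrightarrow> b \<in> B \<Longrightarrow> a < b"
  shows "\<exists>y. (\<forall>a\<in>A. a < y) \<and> (\<forall>b\<in>B. y < b)"
proof -
  consider "A = {}" "B = {}" | "A = {}" "B \<noteq> {}" | "A \<noteq> {}" "B = {}" | "A \<noteq> {}" "B \<noteq> {}"
    by blast
  then show ?thesis
  proof cases
    case 1 then show ?thesis by simp
  next
    case 2
    obtain y where "y < Min B" using lt_ex by blast
    then show ?thesis using 2 assms by auto
  next
    case 3
    obtain y where "Max A < y" using gt_ex by blast
    then show ?thesis using 3 assms by auto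
  next
    case 4
    then have "Max A < Min B" using assms by simp
    then obtain y where "Max A < y" "y < Min B" using dense by blast
    then show ?thesis using 4 assms by auto
  qed
qed

text \<open>Cantor's extension step for a new \<open>x\<close>: the finitely many images of elements below \<open>x\<close> lie below the images
  of those above \<open>x\<close>, and density leaves room between them.\<close>

lemma extend_finite_order_iso:
  fixes p :: "('a :: linorder \<times> 'b :: {dense_linorder, no_top, no_bot}) set"
  assumes fin: "finite p"
    and iso: "\<And>a b a' b'. (a, b) \<in> p \<Longrightarrow> (a', b') \<in> p \<Longrightarrow> a < a' \<longleftrightarrow> b < b'"
  shows "\<exists>y. \<forall>(a, b)\<in>p. (x < a \<longleftrightarrow> y < b) \<and> (a < x \<longleftrightarrow> b < y)"
proof (cases "x \<in> Domain p")
  case True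
  then obtain y where "(x, y) \<in> p" by blast
  then show ?thesis using iso by blast
next
  case False
  define A B where "A = {b. \<exists>a. (a, b) \<in> p \<and> a < x}" and "B = {b. \<exists>a. (a, b) \<in> p \<and> x < a}"
  have "A \<subseteq> snd ` p" "B \<subseteq> snd ` p"
    unfolding A_def B_def by force+
  then have "finite A" "finite B" using fin finite_surj by blast+
  moreover have "b < b'" if "b \<in> A" "b' \<in> B" for b b'
    using that iso unfolding A_def B_def by (blast intro: less_trans)
  ultimately obtain y where y: "\<forall>b\<in>A. b < y" "\<forall>b\<in>B. y < b"
    using between_finite_sets by metis
  have "(x < a \<longleftrightarrow> y < b) \<and> (a < x \<longleftrightarrow> b < y)" if "(a, b) \<in> p" for a b
  proof -
    have "a \<noteq> x" using that False by blast
    then consider "a < x" | "x < a" by fastforce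
    then show ?thesis
    proof cases
      case 1
      then have "b < y" using y that unfolding A_def by blast
      then show ?thesis using 1 by auto
    next
      case 2
      then have "y < b" using y that unfolding B_def by blast
      then show ?thesis using 2 by auto
    qed
  qed
  then show ?thesis by blast
qed

lemma countable_dense_order_homogeneous:
  fixes p :: "('a :: {countable, dense_linorder, no_top, no_bot} \<times>
    'b :: {countable, dense_linorder, no_top, no_bot}) set"
  assumes fin: "finite p"
    and iso: "\<And>a b a' b'. (a, b) \<in> p \<Longrightarrow> (a', b') \<in> p \<Longrightarrow> a < a' \<longleftrightarrow> b < b'"
  obtains f where "bij f" "strict_mono f" "\<And>a b. (a, b) \<in> p \<Longrightarrow> f a = b"
proof -
  define T :: "'a \<times> 'b \<Rightarrow> 'a \<times> 'b \<Rightarrow> bool" where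
    "T = (\<lambda>(a, b) (a', b'). (a < a' \<longleftrightarrow> b < b') \<and> (a' < a \<longleftrightarrow> b' < b))"
  have "\<exists>f. bij f \<and> (\<forall>(a, b)\<in>p. f a = b) \<and> (\<forall>a a'. T (a, f a) (a', f a'))"
  proof (rule back_and_forth[of UNIV UNIV p T])
    show "finite p \<and> p \<subseteq> UNIV \<times> UNIV \<and> (\<forall>u\<in>p. \<forall>v\<in>p. T u v)"
      using fin iso unfolding T_def by auto
    show "a = a' \<longleftrightarrow> b = b'" if "T (a, b) (a', b')" for a b a' b'
      using that unfolding T_def by force
  next
    fix q :: "('a \<times> 'b) set" and x
    assume q: "finite q \<and> q \<subseteq> UNIV \<times> UNIV \<and> (\<forall>u\<in>q. \<forall>v\<in>q. T u v)"
    obtain y where "\<forall>(a, b)\<in>q. (x < a \<longleftrightarrow> y < b) \<and> (a < x \<longleftrightarrow> b < y)"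
      using extend_finite_order_iso[of q x] q unfolding T_def by fast
    then show "\<exists>y\<in>UNIV. \<forall>v\<in>insert (x, y) q. T (x, y) v \<and> T v (x, y)"
      unfolding T_def by (intro bexI[of _ y]) auto
  next
    fix q :: "('a \<times> 'b) set" and y
    assume q: "finite q \<and> q \<subseteq> UNIV \<times> UNIV \<and> (\<forall>u\<in>q. \<forall>v\<in>q. T u v)"
    obtain x where "\<forall>(b, a)\<in>q\<inverse>. (y < b \<longleftrightarrow> x < a) \<and> (b < y \<longleftrightarrow> a < x)"
      using extend_finite_order_iso[of "q\<inverse>" y] q unfolding T_def by fastforce
    then show "\<exists>x\<in>UNIV. \<forall>v\<in>insert (x, y) q. T (x, y) v \<and> T v (x, y)"
      unfolding T_def by (intro bexI[of _ x]) auto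
  qed auto
  then obtain f where f: "bij f" "\<forall>(a, b)\<in>p. f a = b" "\<forall>a a'. T (a, f a) (a', f a')" by blast
  show thesis
  proof
    show "bij f" by fact
    show "strict_mono f" using f(3) unfolding T_def strict_mono_def by auto
    show "f a = b" if "(a, b) \<in> p" for a b using f(2) that by auto
  qed
qed

section \<open>Extending partial isomorphisms of the limit\<close>

lemma equiv_pullback:
  assumes "equiv D Q" "\<And>x. x \<in> S \<Longrightarrow> r x \<in> D"
  shows "equiv S {(x, y) \<in> S \<times> S. (r x, r y) \<in> Q}"
proof (rule equivI)
  show "refl_on S {(x, y) \<in> S \<times> S. (r x, r y) \<in> Q}"
    using assms by (auto intro!: refl_onI elim!: equivE dest: refl_onD)
  show "sym {(x, y) \<in> S \<times> S. (r x, r y) \<in> Q}"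
    using assms(1) by (auto intro!: symI elim!: equivE dest: symD)
  show "trans {(x, y) \<in> S \<times> S. (r x, r y) \<in> Q}"
    using assms(1) by (intro transI) (auto elim!: equivE dest: transD)
qed auto

text \<open>The axioms of \<open>K\<close> speak of at most three elements at a time, so they hold in the limit, all of
  whose finite substructures are in \<open>K\<close>.\<close>

locale K_limit =
  fixes M :: "(nat, ksym) bstruct"
  assumes limit: "fraisse_limit class_K M"
begin

abbreviation "D \<equiv> dom_of M"
abbreviation "E \<equiv> rel_of M SymE"
abbreviation "C i \<equiv> rel_of M (SymC i)"

lemma finite_substructure: "class_K (substructure_on M S)" if "finite S" "S \<subseteq> D"
proof -
  have "embedding (substructure_on M S) M id"
    using that unfolding embedding_def substructure_on_def by simp
  moreover have "finite (dom_of (substructure_on M S))"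
    using that unfolding substructure_on_def by simp
  ultimately show ?thesis using limit unfolding fraisse_limit_def by blast
qed

lemma equiv_E: "equiv D {(x, y) \<in> D \<times> D. E x y}" (is "equiv D ?E")
proof -
  have local: "equiv {x, y, z} {(u, v) \<in> {x, y, z} \<times> {x, y, z}. E u v}"
    if "x \<in> D" "y \<in> D" "z \<in> D" for x y z
    using finite_substructure[of "{x, y, z}"] that
    unfolding class_K_def substructure_on_def Let_def by simp
  show ?thesis
  proof (rule equivI)
    show "refl_on D ?E"
    proof (rule refl_onI)
      show "(x, x) \<in> ?E" if "x \<in> D" for x
        using equiv_class_self[OF local[of x x x], of x] that by simp
    qed
    show "sym ?E"
    proof (rule symI)
      fix x y assume xy: "(x, y) \<in> ?E"
      then have "equiv {x, y, y} {(u, v) \<in> {x, y, y} \<times> {x, y, y}. E u v}" using local by blast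
      then have "sym {(u, v) \<in> {x, y, y} \<times> {x, y, y}. E u v}" by (rule equivE)
      from symD[OF this, of x y] show "(y, x) \<in> ?E" using xy by simp
    qed
    show "trans ?E"
    proof (rule transI)
      fix x y z assume xyz: "(x, y) \<in> ?E" "(y, z) \<in> ?E"
      then have "equiv {x, y, z} {(u, v) \<in> {x, y, z} \<times> {x, y, z}. E u v}" using local by blast
      then have "trans {(u, v) \<in> {x, y, z} \<times> {x, y, z}. E u v}" by (rule equivE)
      from transD[OF this, of x y z] show "(x, z) \<in> ?E" using xyz by simp
    qed
  qed auto
qed

lemma E_refl: "x \<in> D \<Longrightarrow> E x x"
  using equiv_class_self[OF equiv_E, of x] by simp

lemma C_sym: "x \<in> D \<Longrightarrow> y \<in> D \<Longrightarrow> C i x y \<longleftrightarrow> C i y x"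
  and C_irrefl: "x \<in> D \<Longrightarrow> \<not> C i x x"
  and C_unique: "x \<in> D \<Longrightarrow> y \<in> D \<Longrightarrow> x \<noteq> y \<Longrightarrow> \<exists>!i. C i x y"
  and no_triangle: "x \<in> D \<Longrightarrow> y \<in> D \<Longrightarrow> z \<in> D \<Longrightarrow> C i x y \<Longrightarrow> C i y z \<Longrightarrow> C i z x \<Longrightarrow> False"
proof -
  have sel: "dom_of (substructure_on M S) = S" "rel_of (substructure_on M S) = rel_of M" for S
    by (simp_all add: substructure_on_def)
  have K: "class_K (substructure_on M {x, y, z})" if "x \<in> D" "y \<in> D" "z \<in> D" for x y z
    by (rule finite_substructure) (use that in auto)
  note K = K[unfolded class_K_def Let_def sel]
  show "C i x y \<longleftrightarrow> C i y x" if "x \<in> D" "y \<in> D"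
  proof -
    from K[OF that that(2)] have "\<forall>i. \<forall>u\<in>{x, y, y}. \<forall>v\<in>{x, y, y}. C i u v \<longleftrightarrow> C i v u"
      by (elim conjE)
    from bspec[OF bspec[OF spec[OF this]], of x y] show ?thesis by simp
  qed
  show "\<not> C i x x" if "x \<in> D"
  proof -
    from K[OF that that that] have "\<forall>i. \<forall>u\<in>{x, x, x}. \<not> C i u u"
      by (elim conjE)
    from bspec[OF spec[OF this], of x] show ?thesis by simp
  qed
  show "\<exists>!i. C i x y" if "x \<in> D" "y \<in> D" "x \<noteq> y"
  proof -
    from K[OF that(1,2,2)] have "\<forall>u\<in>{x, y, y}. \<forall>v\<in>{x, y, y}. u \<noteq> v \<longrightarrow> (\<exists>!i. C i u v)"
      by (elim conjE)
    from bspec[OF bspec[OF this], of x y] that(3) show ?thesis by simp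
  qed
  show False if "x \<in> D" "y \<in> D" "z \<in> D" and mono: "C i x y" "C i y z" "C i z x"
  proof -
    from K[OF that(1-3)] have "\<not> (\<exists>i. \<exists>u\<in>{x, y, z}. \<exists>v\<in>{x, y, z}. \<exists>w\<in>{x, y, z}.
        C i u v \<and> C i v w \<and> C i w u)"
      by (elim conjE)
    moreover have "\<exists>i. \<exists>u\<in>{x, y, z}. \<exists>v\<in>{x, y, z}. \<exists>w\<in>{x, y, z}.
        C i u v \<and> C i v w \<and> C i w u"
      by (rule exI[of _ i], rule bexI[of _ x], rule bexI[of _ y], rule bexI[of _ z])
        (simp_all add: mono)
    ultimately show False by contradiction
  qed
qed

text \<open>The finite structure to be realised is \<open>T\<close> together with \<open>w\<close> and a new point \<open>u\<close>, equivalent to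
  \<open>w\<close> and joined to each \<open>v\<close> in \<open>T\<close> by the colour \<open>c v\<close>. The admissibility hypothesis is exactly the
  absence of monochromatic triangles through \<open>u\<close> within \<open>T\<close>. The class of the new point is
  given only by the representative \<open>w\<close>, which may or may not belong to \<open>T\<close>; this allows classes that
  do not meet \<open>T\<close>.\<close>

lemma extension_property:
  assumes T: "finite T" "T \<subseteq> D" and w: "w \<in> D"
    and adm: "\<And>v v'. v \<in> T \<Longrightarrow> v' \<in> T \<Longrightarrow> c v = c v' \<Longrightarrow> \<not> C (c v) v v'"
  shows "\<exists>y\<in>D - T. E y w \<and> (\<forall>v\<in>T. C (c v) y v)"
proof -
  define T' where "T' = insert w T"
  have T': "finite T'" "T' \<subseteq> D" using T w unfolding T'_def by auto
  \<comment> \<open>If \<open>w\<close> is not in \<open>T\<close>, a colour \<open>k\<close> different from all \<open>c v\<close> joins it to the new point, so a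
    triangle through \<open>w\<close> and the new point has two sides of distinct colours.\<close>
  obtain k where k: "k \<notin> c ` T"
    using ex_new_if_finite[of "c ` T"] T by auto
  define c' where "c' v = (if v \<in> T then c v else k)" for v
  have adm': "\<not> C (c' v) v v'" if "v \<in> T'" "v' \<in> T'" "c' v = c' v'" for v v'
  proof (cases "v \<in> T \<and> v' \<in> T")
    case True
    then show ?thesis using adm[of v v'] that unfolding c'_def by simp
  next
    case False
    then have "v = w \<and> v' = w" using that k unfolding c'_def T'_def by (auto split: if_splits)
    then show ?thesis using C_irrefl[OF w] by simp
  qed
  obtain u where u: "u \<notin> T'" using ex_new_if_finite[of T'] T' by auto
  \<comment> \<open>\<open>E\<close> on the extended structure is the pullback along \<open>r\<close>, which makes \<open>u\<close> a twin of \<open>w\<close>.\<close>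
  define r where "r x = (if x = u then w else x)" for x
  define A :: "(nat, ksym) bstruct" where
    "A = \<lparr>dom_of = insert u T',
      rel_of = (\<lambda>s x y. case s of
          SymE \<Rightarrow> E (r x) (r y)
        | SymC i \<Rightarrow> if x = u then y \<noteq> u \<and> i = c' y
                   else if y = u then i = c' x else C i x y)\<rparr>"
  have domA: "dom_of A = insert u T'" unfolding A_def by simp
  have rD: "r x \<in> D" if "x \<in> insert u T'" for x using that T' w unfolding r_def by auto
  have T'D: "x \<in> D" if "x \<in> T'" for x using that T' by blast
  have "class_K A"
    unfolding class_K_def Let_def
  proof (intro conjI)
    show "finite (dom_of A)" using T' domA by simp
    show "equiv (dom_of A) {(x, y) \<in> dom_of A \<times> dom_of A. rel_of A SymE x y}"
    proof -
      have "{(x, y) \<in> insert u T' \<times> insert u T'. rel_of A SymE x y} =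
          {(x, y) \<in> insert u T' \<times> insert u T'. (r x, r y) \<in> {(x, y) \<in> D \<times> D. E x y}}"
        using rD unfolding A_def by auto
      then show ?thesis using equiv_pullback[OF equiv_E, of "insert u T'" r] rD domA by simp
    qed
    show "\<forall>i. \<forall>x\<in>dom_of A. \<forall>y\<in>dom_of A. rel_of A (SymC i) x y \<longleftrightarrow> rel_of A (SymC i) y x"
      using C_sym T'D unfolding A_def by auto
    show "\<forall>i. \<forall>x\<in>dom_of A. \<not> rel_of A (SymC i) x x"
      using C_irrefl T'D unfolding A_def by auto
    show "\<forall>x\<in>dom_of A. \<forall>y\<in>dom_of A. x \<noteq> y \<longrightarrow> (\<exists>!i. rel_of A (SymC i) x y)"
    proof (intro ballI impI)
      fix x y assume xy: "x \<in> dom_of A" "y \<in> dom_of A" "x \<noteq> y"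
      then consider "x = u" | "y = u" | "x \<noteq> u" "y \<noteq> u" "x \<in> T'" "y \<in> T'"
        unfolding domA by blast
      then show "\<exists>!i. rel_of A (SymC i) x y"
      proof cases
        case 3
        then show ?thesis using C_unique[of x y] T'D xy(3) unfolding A_def by simp
      qed (use xy(3) in \<open>simp_all add: A_def\<close>)
    qed
    show "\<not> (\<exists>i. \<exists>x\<in>dom_of A. \<exists>y\<in>dom_of A. \<exists>z\<in>dom_of A.
        rel_of A (SymC i) x y \<and> rel_of A (SymC i) y z \<and> rel_of A (SymC i) z x)"
    proof (clarify)
      fix i x y z
      assume xyz: "x \<in> dom_of A" "y \<in> dom_of A" "z \<in> dom_of A"
        and C: "rel_of A (SymC i) x y" "rel_of A (SymC i) y z" "rel_of A (SymC i) z x"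
      have Au: "rel_of A (SymC i) u v \<longleftrightarrow> v \<noteq> u \<and> i = c' v" for v
        unfolding A_def by simp
      have uA: "rel_of A (SymC i) v u \<longleftrightarrow> v \<noteq> u \<and> i = c' v" for v
        unfolding A_def by simp
      have AC: "rel_of A (SymC i) v v' \<longleftrightarrow> C i v v'" if "v \<noteq> u" "v' \<noteq> u" for v v'
        using that unfolding A_def by simp
      \<comment> \<open>A triangle through \<open>u\<close> may be rotated so that it starts at \<open>u\<close>.\<close>
      have star: False
        if "v \<in> dom_of A" "v' \<in> dom_of A" "rel_of A (SymC i) u v"
          "rel_of A (SymC i) v v'" "rel_of A (SymC i) v' u" for v v'
      proof -
        have "v \<noteq> u" "v' \<noteq> u" "i = c' v" "i = c' v'" using that(3,5) Au uA by blast+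
        moreover from this have "v \<in> T'" "v' \<in> T'" "C i v v'" using that(1,2,4) AC domA by blast+
        ultimately show False using adm'[of v v'] by simp
      qed
      show False
      proof (cases "u \<in> {x, y, z}")
        case True
        then show False using star[of y z] star[of z x] star[of x y] xyz C by auto
      next
        case False
        then have ne: "x \<noteq> u" "y \<noteq> u" "z \<noteq> u" by auto
        then have "x \<in> D" "y \<in> D" "z \<in> D" using xyz T'D domA by blast+
        then show False using no_triangle C AC ne by blast
      qed
    qed
  qed
  then obtain e where e: "embedding A M e"
    using limit T' domA unfolding fraisse_limit_def by (metis finite_insert)
  have AT': "rel_of A s x y \<longleftrightarrow> rel_of M s x y" if "x \<in> T'" "y \<in> T'" for s x y
    using that u unfolding A_def r_def by (cases s) auto
  \<comment> \<open>By homogeneity an automorphism agrees with \<open>e\<close> on \<open>T'\<close>, so the preimage of \<open>e u\<close> under it is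
    related to \<open>T'\<close> as \<open>u\<close> is.\<close>
  have "isomorphism (substructure_on M T') (substructure_on M (e ` T')) e"
    unfolding isomorphism_def embedding_def substructure_on_def
  proof (simp, intro conjI ballI allI)
    show "inj_on e T'"
      using e inj_on_subset[of e "dom_of A" T'] domA unfolding embedding_def by auto
    show "rel_of M s x y \<longleftrightarrow> rel_of M s (e x) (e y)" if "x \<in> T'" "y \<in> T'" for s x y
      using AT'[OF that, of s] e that unfolding embedding_def domA by blast
  qed
  moreover have eD: "e ` insert u T' \<subseteq> D" using e domA unfolding embedding_def by simp
  then have "e ` T' \<subseteq> D" by simp
  moreover have "ultrahomogeneous M" using limit unfolding fraisse_limit_def by simp
  ultimately have "\<exists>g. automorphism M g \<and> (\<forall>x\<in>T'. g x = e x)"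
    using T' unfolding ultrahomogeneous_def by simp
  then obtain g where g: "automorphism M g" "\<And>x. x \<in> T' \<Longrightarrow> g x = e x" by blast
  have gD: "g ` D = D"
    and g_rel: "\<And>s v v'. v \<in> D \<Longrightarrow> v' \<in> D \<Longrightarrow> rel_of M s v v' \<longleftrightarrow> rel_of M s (g v) (g v')"
    using g(1) unfolding automorphism_def isomorphism_def embedding_def by simp_all
  have "e u \<in> g ` D" using eD gD by simp
  then obtain y where y: "y \<in> D" "g y = e u" by (auto simp: image_iff)
  have transfer: "rel_of M s y v \<longleftrightarrow> rel_of A s u v" if v: "v \<in> T'" for s v
  proof -
    have "rel_of M s y v \<longleftrightarrow> rel_of M s (e u) (e v)"
      using g_rel[OF y(1) T'D[OF v], of s] y g(2)[OF v] by simp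
    also have "\<dots> \<longleftrightarrow> rel_of A s u v"
      using e v unfolding embedding_def domA by simp
    finally show ?thesis .
  qed
  have "E y w"
    using transfer[of w SymE] u E_refl[OF w] unfolding A_def r_def T'_def by simp
  moreover have C: "C (c v) y v" if "v \<in> T" for v
  proof -
    have "v \<in> T'" "v \<noteq> u" "c' v = c v" using that u unfolding T'_def c'_def by auto
    then show ?thesis using transfer[of v "SymC (c v)"] unfolding A_def by simp
  qed
  moreover have "y \<notin> T" using C C_irrefl[OF y(1)] by blast
  ultimately show ?thesis using y(1) by blast
qed

text \<open>The map \<open>p\<close> preserves equality and colours only. The equivalence relation enters through the
  target class, that of \<open>w\<close>, alone, so the same step serves for every permutation of the classes. If
  \<open>x\<close> already has an image, this image has to lie in the target class.\<close>

lemma extend_partial_iso: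
  assumes p: "finite p" "p \<subseteq> D \<times> D"
    and iso: "\<And>a b a' b'. (a, b) \<in> p \<Longrightarrow> (a', b') \<in> p \<Longrightarrow>
        (a = a' \<longleftrightarrow> b = b') \<and> (\<forall>i. C i a a' \<longleftrightarrow> C i b b')"
    and x: "x \<in> D" and w: "w \<in> D"
    and xw: "\<And>a. (x, a) \<in> p \<Longrightarrow> E a w"
  shows "\<exists>y\<in>D. E y w \<and> (\<forall>a b. (a, b) \<in> p \<longrightarrow> (x = a \<longleftrightarrow> y = b) \<and> (\<forall>i. C i x a \<longleftrightarrow> C i y b))"
proof (cases "x \<in> Domain p")
  case True
  then obtain y where "(x, y) \<in> p" by blast
  then show ?thesis using iso xw p by (intro bexI[of _ y]) auto
next
  case False
  define h where "h b = (SOME a. (a, b) \<in> p)" for b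
  have h: "(h b, b) \<in> p" if "b \<in> Range p" for b
    using that unfolding h_def by (auto intro: someI)
  have h_eq: "h b = a" if "(a, b) \<in> p" for a b
    using iso[OF that h] that by blast
  define c where "c b = (THE i. C i x (h b))" for b
  have c: "C i x (h b) \<longleftrightarrow> i = c b" if "b \<in> Range p" for b i
  proof -
    have "h b \<in> D" "x \<noteq> h b" using h[OF that] p False by auto
    then have "\<exists>!i. C i x (h b)" using C_unique[OF x] by simp
    then show ?thesis unfolding c_def by (metis theI')
  qed
  have "\<exists>y\<in>D - Range p. E y w \<and> (\<forall>v\<in>Range p. C (c v) y v)"
  proof (rule extension_property[OF _ _ w])
    show "finite (Range p)" using p(1) by (simp add: finite_Range)
    show "Range p \<subseteq> D" using p(2) by blast
    show "\<not> C (c v) v v'" if v: "v \<in> Range p" "v' \<in> Range p" "c v = c v'" for v v'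
    proof
      assume "C (c v) v v'"
      then have "C (c v) (h v) (h v')" using iso[OF h h] v by blast
      moreover have "C (c v) x (h v)" "C (c v) x (h v')" using c v by auto
      moreover have hD: "h v \<in> D" "h v' \<in> D" using h v p by blast+
      ultimately show False
        using no_triangle[OF x hD, of "c v"] C_sym[OF x hD(2)] by blast
    qed
  qed
  then obtain y where y: "y \<in> D" "y \<notin> Range p" "E y w" "\<And>v. v \<in> Range p \<Longrightarrow> C (c v) y v"
    by blast
  have "(x = a \<longleftrightarrow> y = b) \<and> (\<forall>i. C i x a \<longleftrightarrow> C i y b)" if ab: "(a, b) \<in> p" for a b
  proof -
    have "b \<in> Range p" "a = h b" using h_eq ab by auto
    moreover have "x \<noteq> a" "y \<noteq> b" "b \<in> D" using ab False y(2) p by auto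
    moreover have "C i y b \<longleftrightarrow> i = c b" for i
      using C_unique[OF y(1) \<open>b \<in> D\<close> \<open>y \<noteq> b\<close>] y(4)[OF \<open>b \<in> Range p\<close>] by blast
    ultimately show ?thesis using c by auto
  qed
  then show ?thesis using y by blast
qed

section \<open>Permutations of the classes lift to automorphisms\<close>

text \<open>A back-and-forth construction with finite maps that preserve colours and induce \<open>\<pi>\<close> on classes.
  A new element \<open>x\<close> must be sent into the class \<open>\<pi> (R x)\<close>, and \<open>extend_partial_iso\<close> allows this for
  every class. In the backward direction the same lemma is applied to the converse map and the
  inverse of \<open>\<pi>\<close>. Preservation of \<open>E\<close> need not be demanded during the construction: it follows from
  the action on classes, \<open>\<pi>\<close> being injective.\<close>

lemma lift_class_permutation:
  assumes R: "R ` D = F" "\<And>x y. x \<in> D \<Longrightarrow> y \<in> D \<Longrightarrow> R x = R y \<longleftrightarrow> E x y"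
    and \<pi>: "bij_betw \<pi> F F"
  obtains g where "automorphism M g" "\<And>x. x \<in> D \<Longrightarrow> R (g x) = \<pi> (R x)"
proof -
  define T :: "nat \<times> nat \<Rightarrow> nat \<times> nat \<Rightarrow> bool" where
    "T = (\<lambda>(a, b) (a', b'). (a = a' \<longleftrightarrow> b = b') \<and> (\<forall>i. C i a a' \<longleftrightarrow> C i b b') \<and> R b = \<pi> (R a))"
  have \<pi>F: "\<pi> l \<in> F" if "l \<in> F" for l using \<pi> that bij_betwE by blast
  have RF: "R x \<in> F" if "x \<in> D" for x using R(1) that by blast
  have T_iso: "(a = a' \<longleftrightarrow> b = b') \<and> (\<forall>i. C i a a' \<longleftrightarrow> C i b b')" and T_R: "R b = \<pi> (R a)"
    if "\<forall>u\<in>q. \<forall>v\<in>q. T u v" "(a, b) \<in> q" "(a', b') \<in> q" for q a b a' b'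
    using bspec[OF bspec[OF that(1) that(2)] that(3)] unfolding T_def by simp_all
  have ins: "\<forall>v\<in>insert (x, y) q. T (x, y) v \<and> T v (x, y)"
    if q: "q \<subseteq> D \<times> D" "\<forall>u\<in>q. \<forall>v\<in>q. T u v" and xy: "x \<in> D" "y \<in> D" "R y = \<pi> (R x)"
      and new: "\<And>a b. (a, b) \<in> q \<Longrightarrow> (x = a \<longleftrightarrow> y = b) \<and> (\<forall>i. C i x a \<longleftrightarrow> C i y b)" for x y q
  proof -
    have "T (x, y) (x, y)" using C_irrefl xy unfolding T_def by auto
    moreover have "T (x, y) v \<and> T v (x, y)" if v: "v \<in> q" for v
    proof -
      obtain a b where ab: "v = (a, b)" by (cases v)
      have "R b = \<pi> (R a)" using q(2) v unfolding ab T_def by auto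
      moreover have "a \<in> D" "b \<in> D" using q(1) v ab by auto
      ultimately have "C i a x \<longleftrightarrow> C i b y" for i
        using new[of a b] v ab C_sym[OF xy(1), of a i] C_sym[OF xy(2), of b i] by blast
      then show ?thesis
        using new[of a b] v xy(3) \<open>R b = \<pi> (R a)\<close> unfolding ab T_def by auto
    qed
    ultimately show ?thesis by blast
  qed
  have "\<exists>g. bij_betw g D D \<and> (\<forall>a\<in>D. \<forall>a'\<in>D. T (a, g a) (a', g a'))"
  proof (rule back_and_forth[of D D "{}" T])
    show "countable D" "countable D" using limit unfolding fraisse_limit_def by auto
    show "a = a' \<longleftrightarrow> b = b'" if "T (a, b) (a', b')" for a b a' b'
      using that unfolding T_def by auto
  next
    fix q x
    assume "finite q \<and> q \<subseteq> D \<times> D \<and> (\<forall>u\<in>q. \<forall>v\<in>q. T u v)" and x: "x \<in> D"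
    then have q: "finite q" "q \<subseteq> D \<times> D" and qT: "\<forall>u\<in>q. \<forall>v\<in>q. T u v" by simp_all
    obtain w where w: "w \<in> D" "R w = \<pi> (R x)"
      using \<pi>F[OF RF[OF x]] unfolding R(1)[symmetric] by auto
    have "\<exists>y\<in>D. E y w \<and> 
        (\<forall>a b. (a, b) \<in> q \<longrightarrow> (x = a \<longleftrightarrow> y = b) \<and> (\<forall>i. C i x a \<longleftrightarrow> C i y b))"
    proof (rule extend_partial_iso)
      show "finite q" "q \<subseteq> D \<times> D" "x \<in> D" "w \<in> D" using q x w by simp_all
      show "(a = a' \<longleftrightarrow> b = b') \<and> (\<forall>i. C i a a' \<longleftrightarrow> C i b b')"
        if "(a, b) \<in> q" "(a', b') \<in> q" for a b a' b'
        using T_iso[OF qT that] .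
      show "E a w" if "(x, a) \<in> q" for a
      proof -
        have "R a = \<pi> (R x)" "a \<in> D" using T_R[OF qT that that] q(2) that by auto
        then show ?thesis using R(2)[of a w] w by simp
      qed
    qed
    then obtain y where y: "y \<in> D" "E y w"
      and new: "\<And>a b. (a, b) \<in> q \<Longrightarrow> (x = a \<longleftrightarrow> y = b) \<and> (\<forall>i. C i x a \<longleftrightarrow> C i y b)" by blast
    have "R y = \<pi> (R x)" using R(2)[of y w] y w by simp
    then show "\<exists>y\<in>D. \<forall>v\<in>insert (x, y) q. T (x, y) v \<and> T v (x, y)"
      using ins[OF q(2) qT x y(1) _ new] y(1) by blast
  next
    fix q y
    assume "finite q \<and> q \<subseteq> D \<times> D \<and> (\<forall>u\<in>q. \<forall>v\<in>q. T u v)" and y: "y \<in> D"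
    then have q: "finite q" "q \<subseteq> D \<times> D" and qT: "\<forall>u\<in>q. \<forall>v\<in>q. T u v" by simp_all
    obtain w where w: "w \<in> D" "R y = \<pi> (R w)"
    proof -
      have "R y \<in> \<pi> ` R ` D" using RF[OF y] bij_betw_imp_surj_on[OF \<pi>] R(1) by simp
      then show thesis using that by blast
    qed
    have "\<exists>x\<in>D. E x w \<and> 
        (\<forall>b a. (b, a) \<in> q\<inverse> \<longrightarrow> (y = b \<longleftrightarrow> x = a) \<and> (\<forall>i. C i y b \<longleftrightarrow> C i x a))"
    proof (rule extend_partial_iso)
      show "finite (q\<inverse>)" "q\<inverse> \<subseteq> D \<times> D" "y \<in> D" "w \<in> D"
        using q y w by auto
      show "(b = b' \<longleftrightarrow> a = a') \<and> (\<forall>i. C i b b' \<longleftrightarrow> C i a a')"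
        if "(b, a) \<in> q\<inverse>" "(b', a') \<in> q\<inverse>" for a b a' b'
        using T_iso[OF qT, of a b a' b'] that by simp
      show "E a w" if "(y, a) \<in> q\<inverse>" for a
      proof -
        have ay: "(a, y) \<in> q" using that by simp
        then have "\<pi> (R a) = \<pi> (R w)" "a \<in> D" using T_R[OF qT ay ay] q(2) w by auto
        then have "R a = R w" using \<pi> RF w unfolding bij_betw_def by (meson inj_onD)
        then show ?thesis using R(2)[of a w] w \<open>a \<in> D\<close> by simp
      qed
    qed
    then obtain x where x: "x \<in> D" "E x w"
      and new: "\<And>a b. (a, b) \<in> q \<Longrightarrow> (x = a \<longleftrightarrow> y = b) \<and> (\<forall>i. C i x a \<longleftrightarrow> C i y b)" by auto
    have "R y = \<pi> (R x)" using R(2)[of x w] x w by simp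
    then show "\<exists>x\<in>D. \<forall>v\<in>insert (x, y) q. T (x, y) v \<and> T v (x, y)"
      using ins[OF q(2) qT x(1) y _ new] x(1) by blast
  next
    fix g assume "bij_betw g D D" "\<And>a a'. a \<in> D \<Longrightarrow> a' \<in> D \<Longrightarrow> T (a, g a) (a', g a')"
    then show "\<exists>g. bij_betw g D D \<and> (\<forall>a\<in>D. \<forall>a'\<in>D. T (a, g a) (a', g a'))" by blast
  qed simp_all
  then obtain g where g: "bij_betw g D D" "\<And>a a'. a \<in> D \<Longrightarrow> a' \<in> D \<Longrightarrow> T (a, g a) (a', g a')"
    by blast
  have Rg: "R (g x) = \<pi> (R x)" if "x \<in> D" for x
    using g(2)[OF that that] unfolding T_def by simp
  have gD: "g x \<in> D" if "x \<in> D" for x using g(1) that bij_betwE by blast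
  have "rel_of M s x y \<longleftrightarrow> rel_of M s (g x) (g y)" if "x \<in> D" "y \<in> D" for s x y
  proof (cases s)
    case SymE
    have "R x = R y \<longleftrightarrow> \<pi> (R x) = \<pi> (R y)"
      using inj_on_eq_iff[OF bij_betw_imp_inj_on[OF \<pi>] RF RF] that by simp
    then show ?thesis using SymE R(2)[OF that] R(2)[OF gD gD] Rg that by simp
  next
    case (SymC i)
    then show ?thesis using g(2)[OF that] unfolding T_def by simp
  qed
  moreover have "inj_on g D" "g ` D = D" using g(1) unfolding bij_betw_def by simp_all
  ultimately have "automorphism M g"
    unfolding automorphism_def isomorphism_def embedding_def by blast
  then show thesis using Rg that by blast
qed

end

section \<open>Indiscernible points of the Harrison ordering\<close>

lemma Field_times_one_plus_eta:
  assumes "Well_order W"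
  shows "Field (times_one_plus_eta W) = UNIV \<times> Field W"
proof -
  have "(a, a) \<in> W" if "a \<in> Field W" for a
    using assms that unfolding order_on_defs by (auto dest: refl_onD)
  then have "((q, a), (q, a)) \<in> times_one_plus_eta W" if "a \<in> Field W" for q a
    using that unfolding times_one_plus_eta_def by simp
  then show ?thesis
    unfolding times_one_plus_eta_def Field_def by fastforce
qed

text \<open>The empty order is a computable ordinal.\<close>

lemma is_omega1_CK_nonempty:
  assumes "is_omega1_CK (W :: nat rel)"
  obtains a where "a \<in> Field W"
proof (cases "W = {}")
  case True
  have "computable_rel {}"
    unfolding computable_rel_def computable_predicate_def
    using recursive.zero by (intro exI[of _ "\<lambda>xs. 0"]) simp
  then have "computable_ordinal W"
    using assms True ordIso_reflexive unfolding computable_ordinal_def is_omega1_CK_def by blast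
  then show ?thesis using assms unfolding is_omega1_CK_def by blast
next
  case False
  then show ?thesis using that unfolding Field_def by fast
qed

text \<open>The points are the occurrences of one fixed \<open>a\<close> in the copies of \<open>W\<close> at the rational positions
  \<open>0, 1, 2, \<dots>\<close>. An automorphism of the rationals, applied to the dominant coordinate and fixing the
  bottom position \<open>None\<close>, moves these copies and respects the order.\<close>

lemma harrison_ordering_indiscernibles:
  assumes "harrison_ordering L"
  obtains s :: "nat \<Rightarrow> nat" where "inj s" "range s \<subseteq> Field L"
    and "\<And>n i j. strict_mono_on {1..n::nat} i \<Longrightarrow> strict_mono_on {1..n} j \<Longrightarrow>
      \<exists>\<pi>. bij_betw \<pi> (Field L) (Field L) \<and>
        (\<forall>x\<in>Field L. \<forall>y\<in>Field L. (x, y) \<in> L \<longleftrightarrow> (\<pi> x, \<pi> y) \<in> L) \<and>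
        (\<forall>k\<in>{1..n}. \<pi> (s (i k)) = s (j k))"
proof -
  obtain W :: "nat rel" and h where W: "is_omega1_CK W"
    and h: "bij_betw h (Field L) (Field (times_one_plus_eta W))"
      "\<And>x y. x \<in> Field L \<Longrightarrow> y \<in> Field L \<Longrightarrow> (x, y) \<in> L \<longleftrightarrow> (h x, h y) \<in> times_one_plus_eta W"
    using assms unfolding harrison_ordering_def order_isomorphic_def by blast
  obtain a where a: "a \<in> Field W" using is_omega1_CK_nonempty[OF W] .
  define H where "H = (UNIV :: rat option set) \<times> Field W"
  have H: "Field (times_one_plus_eta W) = H"
    using Field_times_one_plus_eta W unfolding is_omega1_CK_def H_def by blast
  define h' where "h' = inv_into (Field L) h"
  have h': "bij_betw h' H (Field L)" using h(1) H unfolding h'_def by (simp add: bij_betw_inv_into)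
  have hh': "h (h' z) = z" if "z \<in> H" for z
    using h(1) H that unfolding h'_def by (simp add: bij_betw_inv_into_right)
  have h'h: "h' (h x) = x" if "x \<in> Field L" for x
    using h(1) H that unfolding h'_def by (simp add: bij_betw_inv_into_left)
  define s where "s n = h' (Some (of_nat n), a)" for n
  have sH: "(Some (of_nat n), a) \<in> H" for n using a unfolding H_def by simp
  show thesis
  proof
    show "inj s"
    proof (rule injI)
      fix m n assume "s m = s n"
      then have "h (s m) = h (s n)" by simp
      then show "m = n" unfolding s_def using hh'[OF sH] by simp
    qed
    show "range s \<subseteq> Field L"
      using h' sH unfolding s_def by (auto dest: bij_betwE)
  next
    fix n :: nat and i j :: "nat \<Rightarrow> nat"
    assume i: "strict_mono_on {1..n} i" and j: "strict_mono_on {1..n} j"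
    define p where "p = (\<lambda>k. (of_nat (i k), of_nat (j k)) :: rat \<times> rat) ` {1..n}"
    have "finite p" unfolding p_def by simp
    moreover have "x < x' \<longleftrightarrow> y < y'" if "(x, y) \<in> p" "(x', y') \<in> p" for x y x' y'
      using that strict_mono_on_less[OF i] strict_mono_on_less[OF j] unfolding p_def by auto
    ultimately obtain f where f: "bij f" "strict_mono f" "\<And>x y. (x, y) \<in> p \<Longrightarrow> f x = y"
      using countable_dense_order_homogeneous by blast
    define \<sigma> :: "rat option \<times> nat \<Rightarrow> rat option \<times> nat" where
      "\<sigma> = map_prod (map_option f) id"
    have map_less: "map_option f q < map_option f q' \<longleftrightarrow> q < q'" for q q'
      using strict_mono_less[OF f(2)] by (cases q; cases q') auto
    have "bij (map_option f)"
    proof (rule bijI)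
      show "inj (map_option f)" using f(1) by (simp add: bij_is_inj option.inj_map)
      show "surj (map_option f)"
      proof (rule surjI)
        show "map_option f (map_option (inv f) q) = q" for q
          using f(1) by (cases q) (simp_all add: bij_is_surj surj_f_inv_f)
      qed
    qed
    then have \<sigma>: "bij_betw \<sigma> H H"
      unfolding \<sigma>_def H_def by (intro bij_betw_map_prod) auto
    have \<sigma>H: "\<sigma> z \<in> H" if "z \<in> H" for z using \<sigma> that bij_betwE by blast
    have \<sigma>_ord: "(z, z') \<in> times_one_plus_eta W \<longleftrightarrow> (\<sigma> z, \<sigma> z') \<in> times_one_plus_eta W" for z z'
      using inj_eq[OF option.inj_map[OF bij_is_inj[OF f(1)]]]
      unfolding times_one_plus_eta_def \<sigma>_def by (cases z; cases z') (simp add: map_less)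
    define \<pi> where "\<pi> = h' \<circ> \<sigma> \<circ> h"
    have hL: "h x \<in> H" if "x \<in> Field L" for x using h(1) H that bij_betwE by blast
    have \<pi>: "bij_betw \<pi> (Field L) (Field L)"
      using bij_betw_trans[OF bij_betw_trans[OF h(1)[unfolded H] \<sigma>] h']
      unfolding \<pi>_def by (simp add: comp_assoc)
    have \<pi>_ord: "(x, y) \<in> L \<longleftrightarrow> (\<pi> x, \<pi> y) \<in> L" if "x \<in> Field L" "y \<in> Field L" for x y
    proof -
      have "\<pi> x \<in> Field L" "\<pi> y \<in> Field L"
        using bij_betwE[OF \<pi>] that by simp_all
      then have "(\<pi> x, \<pi> y) \<in> L \<longleftrightarrow> (h (\<pi> x), h (\<pi> y)) \<in> times_one_plus_eta W"
        by (rule h(2))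
      moreover have "h (\<pi> x) = \<sigma> (h x)" "h (\<pi> y) = \<sigma> (h y)"
        using hh' \<sigma>H hL that unfolding \<pi>_def by simp_all
      ultimately show ?thesis using h(2)[OF that] \<sigma>_ord[of "h x" "h y"] by simp
    qed
    have \<pi>_s: "\<pi> (s (i k)) = s (j k)" if "k \<in> {1..n}" for k
    proof -
      have "f (of_nat (i k)) = of_nat (j k)" using f(3) that unfolding p_def by blast
      then show ?thesis using hh'[OF sH] unfolding \<pi>_def s_def \<sigma>_def by simp
    qed
    show "\<exists>\<pi>. bij_betw \<pi> (Field L) (Field L) \<and>
        (\<forall>x\<in>Field L. \<forall>y\<in>Field L. (x, y) \<in> L \<longleftrightarrow> (\<pi> x, \<pi> y) \<in> L) \<and>
        (\<forall>k\<in>{1..n}. \<pi> (s (i k)) = s (j k))"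
      using \<pi> \<pi>_ord \<pi>_s by blast
  qed
qed

section \<open>The indiscernible sequence of imaginaries\<close>

theorem proposition3p3:
  fixes M :: "(nat, ksym) bstruct" and L :: "nat rel" and R :: "nat \<Rightarrow> nat"
  assumes "fraisse_limit class_K M" and "computable_kstructure M"
    and "harrison_ordering L"
    and "ranking M L R"
  shows "\<exists>X. indiscernible_imaginaries (expansion_N M L R) X"
proof -
  interpret K_limit M by unfold_locales fact
  let ?N = "expansion_N M L R"
  have R: "R ` D = Field L" "\<And>x y. x \<in> D \<Longrightarrow> y \<in> D \<Longrightarrow> R x = R y \<longleftrightarrow> E x y"
    using assms(4) unfolding ranking_def by auto
  obtain s :: "nat \<Rightarrow> nat" where s: "inj s" "range s \<subseteq> Field L"
    and hom: "\<And>n i j. strict_mono_on {1..n::nat} i \<Longrightarrow> strict_mono_on {1..n} j \<Longrightarrow>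
      \<exists>\<pi>. bij_betw \<pi> (Field L) (Field L) \<and>
        (\<forall>x\<in>Field L. \<forall>y\<in>Field L. (x, y) \<in> L \<longleftrightarrow> (\<pi> x, \<pi> y) \<in> L) \<and>
        (\<forall>k\<in>{1..n}. \<pi> (s (i k)) = s (j k))"
    using harrison_ordering_indiscernibles[OF assms(3)] by blast
  have domN: "dom_of ?N = D" unfolding expansion_N_def by simp
  define X where "X n = {x \<in> D. R x = s n}" for n
  have X_ne: "\<exists>x\<in>D. R x = s n" for n using R(1) s(2) by (metis image_iff range_subsetD)
  define Q where "Q = {(x, y) \<in> D \<times> D. R x = R y}"
  have "equiv D Q"
    unfolding Q_def by (intro equivI refl_onI symI transI) auto
  moreover have "Q = defined_relation ?N (FRel (SymK SymE) 0 1)"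
    using R(2) unfolding Q_def defined_relation_def domN by (auto simp: expansion_N_def)
  ultimately have "definable_equivalence ?N Q"
    unfolding definable_equivalence_def domN
    by (intro conjI exI[of _ "FRel (SymK SymE) 0 1"]) auto
  moreover have "X n \<in> dom_of ?N // Q" for n
  proof -
    obtain x where x: "x \<in> D" "R x = s n" using X_ne by blast
    then have "X n = Q `` {x}" unfolding X_def Q_def by auto
    then show ?thesis using x unfolding domN by (simp add: quotientI)
  qed
  moreover have "inj X"
  proof (rule injI)
    fix m n assume "X m = X n"
    then have "s m = s n" using X_ne[of m] unfolding X_def by auto
    then show "m = n" using s(1) by (simp add: injD)
  qed
  moreover have "\<exists>g. automorphism ?N g \<and> (\<forall>k\<in>{1..n}. g ` X (i k) = X (j k))"
    if ij: "strict_mono_on {1..n} i" "strict_mono_on {1..n} j" for n :: nat and i j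
  proof -
    obtain \<pi> where \<pi>: "bij_betw \<pi> (Field L) (Field L)"
      "\<And>x y. x \<in> Field L \<Longrightarrow> y \<in> Field L \<Longrightarrow> (x, y) \<in> L \<longleftrightarrow> (\<pi> x, \<pi> y) \<in> L"
      "\<And>k. k \<in> {1..n} \<Longrightarrow> \<pi> (s (i k)) = s (j k)"
      using hom[OF ij] by blast
    obtain g where g: "automorphism M g" "\<And>x. x \<in> D \<Longrightarrow> R (g x) = \<pi> (R x)"
      using lift_class_permutation[OF R \<pi>(1)] by blast
    have RF: "R x \<in> Field L" if "x \<in> D" for x using R(1) that by blast
    have g_rel: "rel_of M k x y \<longleftrightarrow> rel_of M k (g x) (g y)" if "x \<in> D" "y \<in> D" for k x y
      using g(1) that unfolding automorphism_def isomorphism_def embedding_def by blast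
    have "rel_of ?N r x y \<longleftrightarrow> rel_of ?N r (g x) (g y)" if "x \<in> D" "y \<in> D" for r x y
    proof (cases r)
      case (SymK k)
      then show ?thesis using g_rel[OF that, of k] unfolding expansion_N_def by simp
    next
      case SymLe
      then show ?thesis
        using \<pi>(2)[OF RF RF] g(2) that unfolding expansion_N_def by simp
    qed
    moreover have "inj_on g D" and gD: "g ` D = D"
      using g(1) unfolding automorphism_def isomorphism_def embedding_def by simp_all
    ultimately have "automorphism ?N g"
      unfolding automorphism_def isomorphism_def embedding_def domN by blast
    moreover have "g ` X (i k) = X (j k)" if k: "k \<in> {1..n}" for k
    proof -
      have Rg: "R (g x) = s (j k) \<longleftrightarrow> R x = s (i k)" if "x \<in> D" for x
      proof -
        have "s (i k) \<in> Field L" using s(2) by blast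
        then have "\<pi> (R x) = \<pi> (s (i k)) \<longleftrightarrow> R x = s (i k)"
          using inj_on_eq_iff[OF bij_betw_imp_inj_on[OF \<pi>(1)] RF] that by simp
        then show ?thesis using g(2)[OF that] \<pi>(3)[OF k] by simp
      qed
      show ?thesis
      proof
        show "g ` X (i k) \<subseteq> X (j k)" using gD Rg unfolding X_def by blast
        show "X (j k) \<subseteq> g ` X (i k)"
        proof
          fix y assume "y \<in> X (j k)"
          then have "y \<in> g ` D" "R y = s (j k)" unfolding X_def gD by simp_all
          then show "y \<in> g ` X (i k)" using Rg unfolding X_def by blast
        qed
      qed
    qed
    ultimately show ?thesis by blast
  qed
  ultimately show ?thesis unfolding indiscernible_imaginaries_def by blast
qed

end
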